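(* Let $\{E_J,\pi^K_J\}_{J,K\in A}$ be a perfect inverse system with projective limit $E_A$, let $\{L_J,\hat E_J^0\}_{J\in A}$ be a projective system of functionals on it, and let $L_{min}:\mathcal{C}_0\to\mathbb{C}$ be its minimal extension. Let $\tau$ be a topology on $\hat E_A$ such that $(\hat E_A,\tau)$ is a topological vector space. If $L_{min}:\mathcal{C}_0\to\mathbb{C}$ is continuous in the $\tau$ topology on $\mathcal{C}_0$ (the topology induced by $\tau$ on $\mathcal{C}_0\subseteq\hat E_A$), then $L_{min}$ is closable in $\tau$.
   Context: Projective families. A directed set $A$ is a partially ordered set $(A,\le)$ such that for all $J,K\in A$ there is $R\in A$ with $J\le R$, $K\le R$. A projective (inverse) family of sets $\{E_J,\pi^K_J\}_{J,K\in A}$ consists of non-empty sets $E_J$ indexed by a non-empty directed set $A$ and, for every $J\le K$, a surjective map $\pi^K_J:E_K\to E_J$, such that $\pi^K_K=\mathrm{id}_{E_K}$ and $\pi^R_J=\pi^K_J\circ\pi^R_K$ for $J\le K\le R$. Its projective limit is $$E_A:=\{(x_J)_{J\in A}\in\prod_{J\in A}E_J : x_J=\pi^K_J(x_K)\ \text{for all } J\le K\},$$ and $\pi_J:E_A\to E_J$ denotes the restriction to $E_A$ of the coordinate projection. The family is called a perfect inverse system if for every $J\in A$ and $x_J\in E_J$ there is $x\in E_A$ with $\pi_J x=x_J$. Functions and extension maps. $\hat E_J$ (resp. $\hat E_A$) is the space of all functions $E_J\to\mathbb{C}$ (resp. $E_A\to\mathbb{C}$). For $J\le K$ the map $\mathcal{E}_J^K:\hat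 E_J\to\hat E_K$ is $\mathcal{E}_J^K(f_J):=f_J\circ\pi^K_J$, and $\mathcal{E}_J^A:\hat E_J\to\hat E_A$ is $\mathcal{E}_J^A f_J:=f_J\circ\pi_J$. Functionals. A functional is a complex-valued linear map defined on a linear subspace (its domain) of a space of complex-valued functions. A projective system of functionals $\{L_J,\hat E_J^0\}_{J\in A}$ is a family of functionals $L_J:\hat E_J^0\to\mathbb{C}$ with domain $\hat E_J^0\subseteq\hat E_J$ such that for all $J\le K$ and all $f_J\in\hat E_J^0$: $\mathcal{E}_J^K(f_J)\in\hat E_K^0$ and $L_K(\mathcal{E}_J^K(f_J))=L_J(f_J)$. Minimal extension. $L_{min}$ has domain $D(L_{min})=\mathcal{C}_0:=\bigcup_{J\in A}\mathcal{E}_J^A(\hat E_J^0)\subseteq\hat E_A$ and is given by $L_{min}(\mathcal{E}_J^A f_J):=L_J(f_J)$ for $J\in A$, $f_J\in\hat E_J^0$ (this is well defined for a perfect inverse system). Closability. $L_{min}$ is closable in $\tau$ if the closure of its graph $\{(f,L_{min}(f)) : f\in\mathcal{C}_0\}$ in $\hat E_A\times\mathbb{C}$, with respect to the product of $\tau$ and the standard topology of $\mathbb{C}$, is the graph of a well-defined functional; i.e. if $(g,\alpha)$ and $(g,\beta)$ both belong to the closure, then $\alpha=\beta$. *)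

theory Defs
  imports "HOL-Analysis.Analysis"
begin

text \<open>The index set is a poset given by a carrier \<open>A\<close> and a relation \<open>r\<close> on it, where
  \<open>(J, K) \<in> r\<close> means \<open>J \<le> K\<close>. The sets \<open>E J\<close> are subsets of one type \<open>'e\<close> (any family of sets
  can be brought into this form by a disjoint union), and \<open>\<pi> J K\<close> is the map from \<open>E K\<close> to \<open>E J\<close>;
  only its values on \<open>E K\<close> matter.\<close>

definition directed_set :: "'i set \<Rightarrow> ('i \<times> 'i) set \<Rightarrow> bool" where
  "directed_set A r \<longleftrightarrow>
     partial_order_on A r \<and> (\<forall>J\<in>A. \<forall>K\<in>A. \<exists>R\<in>A. (J, R) \<in> r \<and> (K, R) \<in> r)"

definition projective_family ::
  "'i set \<Rightarrow> ('i \<times> 'i) set \<Rightarrow> ('i \<Rightarrow> 'e set) \<Rightarrow> ('i \<Rightarrow> 'i \<Rightarrow> 'e \<Rightarrow> 'e) \<Rightarrow> bool" where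
  "projective_family A r E \<pi> \<longleftrightarrow>
     A \<noteq> {} \<and> directed_set A r \<and>
     (\<forall>J\<in>A. E J \<noteq> {}) \<and>
     (\<forall>J K. (J, K) \<in> r \<longrightarrow> \<pi> J K ` E K = E J) \<and>
     (\<forall>K\<in>A. \<forall>x\<in>E K. \<pi> K K x = x) \<and>
     (\<forall>J K R. (J, K) \<in> r \<and> (K, R) \<in> r \<longrightarrow> (\<forall>x\<in>E R. \<pi> J R x = \<pi> J K (\<pi> K R x)))"

definition projective_limit ::
  "'i set \<Rightarrow> ('i \<times> 'i) set \<Rightarrow> ('i \<Rightarrow> 'e set) \<Rightarrow> ('i \<Rightarrow> 'i \<Rightarrow> 'e \<Rightarrow> 'e) \<Rightarrow> ('i \<Rightarrow> 'e) set" where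
  "projective_limit A r E \<pi> = {x \<in> Pi\<^sub>E A E. \<forall>J K. (J, K) \<in> r \<longrightarrow> x J = \<pi> J K (x K)}"

definition perfect_inverse_system ::
  "'i set \<Rightarrow> ('i \<times> 'i) set \<Rightarrow> ('i \<Rightarrow> 'e set) \<Rightarrow> ('i \<Rightarrow> 'i \<Rightarrow> 'e \<Rightarrow> 'e) \<Rightarrow> bool" where
  "perfect_inverse_system A r E \<pi> \<longleftrightarrow>
     projective_family A r E \<pi> \<and>
     (\<forall>J\<in>A. \<forall>y\<in>E J. \<exists>x\<in>projective_limit A r E \<pi>. x J = y)"

text \<open>Complex functions on a set \<open>X\<close> are represented extensionally, i.e. with the value
  \<open>undefined\<close> outside \<open>X\<close>, so that HOL equality is equality of functions on \<open>X\<close>. As the pointwise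
  operations and the zero function have to be restricted to \<open>X\<close> as well, the vector space structure
  is spelled out relative to \<open>X\<close>.\<close>

definition function_space :: "'x set \<Rightarrow> ('x \<Rightarrow> complex) set" where
  "function_space X = X \<rightarrow>\<^sub>E UNIV"

definition fun_add :: "'x set \<Rightarrow> ('x \<Rightarrow> complex) \<Rightarrow> ('x \<Rightarrow> complex) \<Rightarrow> 'x \<Rightarrow> complex" where
  "fun_add X f g = (\<lambda>x\<in>X. f x + g x)"

definition fun_scale :: "'x set \<Rightarrow> complex \<Rightarrow> ('x \<Rightarrow> complex) \<Rightarrow> 'x \<Rightarrow> complex" where
  "fun_scale X c f = (\<lambda>x\<in>X. c * f x)"

definition linear_subspace :: "'x set \<Rightarrow> ('x \<Rightarrow> complex) set \<Rightarrow> bool" where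
  "linear_subspace X D \<longleftrightarrow>
     D \<subseteq> function_space X \<and> (\<lambda>x\<in>X. 0) \<in> D \<and>
     (\<forall>f\<in>D. \<forall>g\<in>D. fun_add X f g \<in> D) \<and> (\<forall>c. \<forall>f\<in>D. fun_scale X c f \<in> D)"

definition is_functional ::
  "'x set \<Rightarrow> ('x \<Rightarrow> complex) set \<Rightarrow> (('x \<Rightarrow> complex) \<Rightarrow> complex) \<Rightarrow> bool" where
  "is_functional X D L \<longleftrightarrow>
     linear_subspace X D \<and>
     (\<forall>f\<in>D. \<forall>g\<in>D. L (fun_add X f g) = L f + L g) \<and>
     (\<forall>c. \<forall>f\<in>D. L (fun_scale X c f) = c * L f)"

text \<open>No separation axiom is required of a topological vector space.\<close>

definition topological_vector_space :: "'x set \<Rightarrow> ('x \<Rightarrow> complex) topology \<Rightarrow> bool" where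
  "topological_vector_space X \<tau> \<longleftrightarrow>
     topspace \<tau> = function_space X \<and>
     continuous_map (prod_topology \<tau> \<tau>) \<tau> (\<lambda>(f, g). fun_add X f g) \<and>
     continuous_map (prod_topology euclidean \<tau>) \<tau> (\<lambda>(c, f). fun_scale X c f)"

definition ext_map ::
  "('i \<Rightarrow> 'e set) \<Rightarrow> ('i \<Rightarrow> 'i \<Rightarrow> 'e \<Rightarrow> 'e) \<Rightarrow> 'i \<Rightarrow> 'i \<Rightarrow> ('e \<Rightarrow> complex) \<Rightarrow> 'e \<Rightarrow> complex" where
  "ext_map E \<pi> J K f = compose (E K) f (\<pi> J K)"

definition ext_lim ::
  "'i set \<Rightarrow> ('i \<times> 'i) set \<Rightarrow> ('i \<Rightarrow> 'e set) \<Rightarrow> ('i \<Rightarrow> 'i \<Rightarrow> 'e \<Rightarrow> 'e) \<Rightarrow>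
   'i \<Rightarrow> ('e \<Rightarrow> complex) \<Rightarrow> ('i \<Rightarrow> 'e) \<Rightarrow> complex" where
  "ext_lim A r E \<pi> J f = compose (projective_limit A r E \<pi>) f (\<lambda>x. x J)"

text \<open>\<open>D J\<close> is the domain of the functional \<open>L J\<close>.\<close>

definition projective_system_of_functionals ::
  "'i set \<Rightarrow> ('i \<times> 'i) set \<Rightarrow> ('i \<Rightarrow> 'e set) \<Rightarrow> ('i \<Rightarrow> 'i \<Rightarrow> 'e \<Rightarrow> 'e) \<Rightarrow>
   ('i \<Rightarrow> ('e \<Rightarrow> complex) set) \<Rightarrow> ('i \<Rightarrow> ('e \<Rightarrow> complex) \<Rightarrow> complex) \<Rightarrow> bool" where
  "projective_system_of_functionals A r E \<pi> D L \<longleftrightarrow>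
     (\<forall>J\<in>A. is_functional (E J) (D J) (L J)) \<and>
     (\<forall>J K. (J, K) \<in> r \<longrightarrow> (\<forall>f\<in>D J.
        ext_map E \<pi> J K f \<in> D K \<and> L K (ext_map E \<pi> J K f) = L J f))"

definition cylinder_functions ::
  "'i set \<Rightarrow> ('i \<times> 'i) set \<Rightarrow> ('i \<Rightarrow> 'e set) \<Rightarrow> ('i \<Rightarrow> 'i \<Rightarrow> 'e \<Rightarrow> 'e) \<Rightarrow>
   ('i \<Rightarrow> ('e \<Rightarrow> complex) set) \<Rightarrow> (('i \<Rightarrow> 'e) \<Rightarrow> complex) set" where
  "cylinder_functions A r E \<pi> D = (\<Union>J\<in>A. ext_lim A r E \<pi> J ` D J)"

definition L_min ::
  "'i set \<Rightarrow> ('i \<times> 'i) set \<Rightarrow> ('i \<Rightarrow> 'e set) \<Rightarrow> ('i \<Rightarrow> 'i \<Rightarrow> 'e \<Rightarrow> 'e) \<Rightarrow>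
   ('i \<Rightarrow> ('e \<Rightarrow> complex) set) \<Rightarrow> ('i \<Rightarrow> ('e \<Rightarrow> complex) \<Rightarrow> complex) \<Rightarrow>
   (('i \<Rightarrow> 'e) \<Rightarrow> complex) \<Rightarrow> complex" where
  "L_min A r E \<pi> D L F = (THE z. \<exists>J\<in>A. \<exists>f\<in>D J. F = ext_lim A r E \<pi> J f \<and> z = L J f)"

text \<open>The definite description in \<open>L_min\<close> is justified by the following two lemmas.\<close>

lemma L_min_well_defined:
  assumes perf: "perfect_inverse_system A r E \<pi>"
    and sys: "projective_system_of_functionals A r E \<pi> D L"
    and J: "J \<in> A" "f \<in> D J" and K: "K \<in> A" "g \<in> D K"
    and eq: "ext_lim A r E \<pi> J f = ext_lim A r E \<pi> K g"
  shows "L J f = L K g"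
proof -
  have "projective_family A r E \<pi>"
    using perf by (simp add: perfect_inverse_system_def)
  then obtain R where R: "R \<in> A" "(J, R) \<in> r" "(K, R) \<in> r"
    using J K unfolding projective_family_def directed_set_def by blast
  have "f (\<pi> J R y) = g (\<pi> K R y)" if y: "y \<in> E R" for y
  proof -
    obtain x where x: "x \<in> projective_limit A r E \<pi>" "x R = y"
      using perf R y unfolding perfect_inverse_system_def by blast
    have "f (x J) = g (x K)"
      using fun_cong[OF eq, of x] x by (simp add: ext_lim_def compose_def)
    moreover have "x J = \<pi> J R y" "x K = \<pi> K R y"
      using x R unfolding projective_limit_def by auto
    ultimately show ?thesis by simp
  qed
  then have "ext_map E \<pi> J R f = ext_map E \<pi> K R g"
    by (auto simp: ext_map_def compose_def restrict_def)
  then show ?thesis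
    using sys R J K unfolding projective_system_of_functionals_def by metis
qed

lemma L_min_ext_lim:
  assumes "perfect_inverse_system A r E \<pi>"
    and "projective_system_of_functionals A r E \<pi> D L"
    and "J \<in> A" "f \<in> D J"
  shows "L_min A r E \<pi> D L (ext_lim A r E \<pi> J f) = L J f"
  unfolding L_min_def
proof (rule the_equality)
  show "\<exists>Ja\<in>A. \<exists>fa\<in>D Ja. ext_lim A r E \<pi> J f = ext_lim A r E \<pi> Ja fa \<and> L J f = L Ja fa"
    using assms(3,4) by blast
qed (metis L_min_well_defined[OF assms])

definition functional_graph :: "('f \<Rightarrow> complex) \<Rightarrow> 'f set \<Rightarrow> ('f \<times> complex) set" where
  "functional_graph L D = (\<lambda>f. (f, L f)) ` D"

definition closable ::
  "'x set \<Rightarrow> ('x \<Rightarrow> complex) topology \<Rightarrow>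
   ('x \<Rightarrow> complex) set \<Rightarrow> (('x \<Rightarrow> complex) \<Rightarrow> complex) \<Rightarrow> bool" where
  "closable X \<tau> D L \<longleftrightarrow>
     (\<exists>D' L'. is_functional X D' L' \<and>
        (prod_topology \<tau> euclidean) closure_of functional_graph L D = functional_graph L' D')"

lemma closable_imp_single_valued:
  assumes "closable X \<tau> D L"
    and "(g, \<alpha>) \<in> (prod_topology \<tau> euclidean) closure_of functional_graph L D"
    and "(g, \<beta>) \<in> (prod_topology \<tau> euclidean) closure_of functional_graph L D"
  shows "\<alpha> = \<beta>"
  using assms unfolding closable_def functional_graph_def by auto

end

theory Submission
  imports Defs
begin

text \<open>By linearity of the closure of the graph, two values over the same \<open>g\<close> differ by a value
  \<open>z\<close> over \<open>0\<close>. Continuity at \<open>0\<close> makes the functional small near \<open>0\<close>, while \<open>z\<close> is a limit of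
  values at points approaching \<open>0\<close>; hence \<open>z = 0\<close>.\<close>

section \<open>Closures of linear graphs in a topological vector space\<close>

text \<open>The closure of a product is the product of the closures, and a continuous map sends the
  closure of a set into the closure of its image. With \<open>S\<close> the graph of a functional
  and \<open>h\<close> the addition of pairs, this makes the closed graph stable under
  addition.\<close>

lemma closure_of_closed_under_binary:
  assumes "continuous_map (prod_topology T T) T (\<lambda>(p, q). h p q)"
    and "\<And>p q. \<lbrakk>p \<in> S; q \<in> S\<rbrakk> \<Longrightarrow> h p q \<in> S"
    and "p \<in> T closure_of S" "q \<in> T closure_of S"
  shows "h p q \<in> T closure_of S"
proof -
  have "(p, q) \<in> prod_topology T T closure_of (S \<times> S)"
    using assms(3,4) by (simp add: closure_of_Times)
  then have "h p q \<in> T closure_of ((\<lambda>(p, q). h p q) ` (S \<times> S))"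
    using continuous_map_image_closure_subset[OF assms(1), of "S \<times> S"] by force
  moreover have "(\<lambda>(p, q). h p q) ` (S \<times> S) \<subseteq> S"
    using assms(2) by auto
  ultimately show ?thesis
    using closure_of_mono by blast
qed

lemma closure_of_closed_under_unary:
  assumes "continuous_map T T h"
    and "\<And>p. p \<in> S \<Longrightarrow> h p \<in> S"
    and "p \<in> T closure_of S"
  shows "h p \<in> T closure_of S"
proof -
  have "h p \<in> T closure_of (h ` S)"
    using continuous_map_image_closure_subset[OF assms(1)] assms(3) by blast
  then show ?thesis
    using closure_of_mono[of "h ` S" S T] assms(2) by blast
qed

text \<open>\<open>closable\<close> asks for more than uniqueness of values: the closure must be the
  graph of a linear functional. So the closed graph is first shown to be stable under the linear
  operations, then single-valued, and the functional is finally read off from it.\<close>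

lemma continuous_functional_closable:
  assumes lin: "is_functional X D L"
    and tvs: "topological_vector_space X \<tau>"
    and cont: "continuous_map (subtopology \<tau> D) euclidean L"
  shows "closable X \<tau> D L"
proof -
  let ?T = "prod_topology \<tau> (euclidean :: complex topology)"
  let ?O = "\<lambda>x\<in>X. 0 :: complex"
  define G where "G = ?T closure_of functional_graph L D"
  have top: "topspace \<tau> = function_space X"
    and cadd: "continuous_map (prod_topology \<tau> \<tau>) \<tau> (\<lambda>(f, g). fun_add X f g)"
    and cscale: "continuous_map (prod_topology euclidean \<tau>) \<tau> (\<lambda>(c, f). fun_scale X c f)"
    using tvs by (auto simp: topological_vector_space_def)
  have sub: "D \<subseteq> function_space X" and zero: "?O \<in> D"
    using lin by (auto simp: is_functional_def linear_subspace_def)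
  have zero_scale: "fun_scale X 0 ?O = ?O"
    \<comment> \<open>The zero vector is zero on \<open>X\<close> and \<open>undefined\<close>
      elsewhere; scaling it by 0 reproduces exactly this function, so homogeneity yields the value 0
      there.\<close>
    by (auto simp: fun_scale_def restrict_def)
  then have L0: "L ?O = 0"
    using lin zero unfolding is_functional_def by (metis mult_zero_left)
  have graph_sub: "functional_graph L D \<subseteq> G"
    unfolding G_def using sub top
    by (intro closure_of_subset) (auto simp: functional_graph_def)
  have G_space: "f \<in> function_space X" if "(f, z) \<in> G" for f z
    using that closure_of_subset_topspace[of ?T "functional_graph L D"]
    unfolding G_def by (auto simp: top)

  have G_add: "(fun_add X f g, a + b) \<in> G" if "(f, a) \<in> G" "(g, b) \<in> G" for f g a b
  proof -
    let ?h = "\<lambda>p q. (fun_add X (fst p) (fst q), snd p + snd q)"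
    \<comment> \<open>Continuity into the product \<open>?T\<close> is checked by components: vector
      addition after projecting both points to their functions, and complex addition of their
      values.\<close>
    have "continuous_map (prod_topology ?T ?T) \<tau>
            ((\<lambda>(f, g). fun_add X f g) \<circ> (\<lambda>pq. (fst (fst pq), fst (snd pq))))"
      by (intro continuous_map_compose[OF _ cadd] continuous_map_pairedI
          continuous_map_fst_of continuous_map_snd_of continuous_map_fst
          continuous_map_compose[OF continuous_map_fst, unfolded o_def]
          continuous_map_compose[OF continuous_map_snd, unfolded o_def])
    moreover have "continuous_map (prod_topology ?T ?T) euclidean
            (\<lambda>pq. snd (fst pq) + snd (snd pq))"
      by (intro continuous_map_add
          continuous_map_compose[OF continuous_map_fst continuous_map_snd, unfolded o_def]
          continuous_map_compose[OF continuous_map_snd continuous_map_snd, unfolded o_def])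
    ultimately have "continuous_map (prod_topology ?T ?T) ?T (\<lambda>(p, q). ?h p q)"
      by (simp add: continuous_map_pairwise o_def case_prod_unfold)
    then have "?h (f, a) (g, b) \<in> G"
      unfolding G_def
    proof (rule closure_of_closed_under_binary)
      show "?h p q \<in> functional_graph L D"
        if "p \<in> functional_graph L D" "q \<in> functional_graph L D" for p q
        using that lin
        by (auto simp: functional_graph_def is_functional_def linear_subspace_def image_iff)
    qed (use that in \<open>auto simp: G_def\<close>)
    then show ?thesis
      by simp
  qed

  have G_scale: "(fun_scale X c f, c * a) \<in> G" if "(f, a) \<in> G" for c f a
  proof -
    let ?h = "\<lambda>p. (fun_scale X c (fst p), c * snd p)"
    \<comment> \<open>Scaling by a fixed \<open>c\<close> is a slice of the jointly continuous
      scalar multiplication.\<close>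
    have "continuous_map ?T \<tau> ((\<lambda>(c, f). fun_scale X c f) \<circ> (\<lambda>p. (c, fst p)))"
      by (intro continuous_map_compose[OF _ cscale] continuous_map_pairedI
          continuous_map_fst) simp
    moreover have "continuous_map ?T euclidean (\<lambda>p. c * snd p)"
      using continuous_map_compose[OF continuous_map_snd, of euclidean euclidean "(*) c" \<tau>]
      by (simp add: o_def continuous_on_mult_left)
    ultimately have "continuous_map ?T ?T ?h"
      by (simp add: continuous_map_pairwise o_def)
    then have "?h (f, a) \<in> G"
      unfolding G_def
    proof (rule closure_of_closed_under_unary)
      show "?h p \<in> functional_graph L D" if "p \<in> functional_graph L D" for p
        using that lin
        by (auto simp: functional_graph_def is_functional_def linear_subspace_def image_iff)
    qed (use that in \<open>auto simp: G_def\<close>)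
    then show ?thesis
      by simp
  qed

  have G_zero: "z = 0" if z: "(?O, z) \<in> G" for z
  proof (rule ccontr)
    assume "z \<noteq> 0"
    \<comment> \<open>Half of the norm suffices: a point of the graph near \<open>(?O, z)\<close>
      will have a value within \<open>e\<close> of 0 and within \<open>e\<close> of
      \<open>z\<close>, which forces the norm of \<open>z\<close> below \<open>2 * e\<close>, that
      is, below itself.\<close>
    define e where "e = norm z / 2"
    have e: "e > 0"
      using \<open>z \<noteq> 0\<close> by (simp add: e_def)
    \<comment> \<open>Continuity holds on \<open>D\<close>, so this set is only relatively open. The
      set \<open>U\<close> is a genuine open set of \<tau> with the same trace on \<open>D\<close>,
      and so can serve in a neighbourhood of \<open>(?O, z)\<close> in the full product.\<close>
    have "openin (subtopology \<tau> D) {f \<in> topspace (subtopology \<tau> D). L f \<in> ball 0 e}"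
      using cont by (rule openin_continuous_map_preimage) simp
    then obtain U where U: "openin \<tau> U"
      and Ueq: "{f \<in> topspace (subtopology \<tau> D). L f \<in> ball 0 e} = U \<inter> D"
      by (auto simp: openin_subtopology)
    have "?O \<in> U"
      using Ueq zero sub top L0 e by auto
    moreover have "openin ?T (U \<times> ball z e)"
      using U by (simp add: openin_prod_Times_iff)
    ultimately have W: "openin ?T (U \<times> ball z e)" "(?O, z) \<in> U \<times> ball z e"
      using e by auto
    then have "\<exists>p \<in> functional_graph L D. p \<in> U \<times> ball z e"
      using z unfolding G_def in_closure_of by metis
    then obtain f where f: "f \<in> D" "f \<in> U" "L f \<in> ball z e"
      by (auto simp: functional_graph_def)
    then have "norm (L f) < e"
      using Ueq by auto
    moreover have "norm (z - L f) < e"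
      using f(3) by (simp add: dist_norm)
    ultimately have "norm z < 2 * e"
      using norm_triangle_ineq[of "z - L f" "L f"] by simp
    then show False
      by (simp add: e_def)
  qed

  have G_single: "a = b" if "(f, a) \<in> G" "(f, b) \<in> G" for f a b
  proof -
    \<comment> \<open>Subtracting the two points of the closed graph over \<open>f\<close> gives a
      point over the zero function, where the value is already known to be 0.\<close>
    have "fun_add X f (fun_scale X (- 1) f) = ?O"
      by (auto simp: fun_add_def fun_scale_def restrict_def)
    then have "(?O, a - b) \<in> G"
      using G_add[OF that(1) G_scale[OF that(2), of "- 1"]] by simp
    then show ?thesis
      using G_zero by fastforce
  qed

  define D' where "D' = fst ` G"
  define L' where "L' f = (THE z. (f, z) \<in> G)" for f
  have L'_eq: "L' f = z" if "(f, z) \<in> G" for f z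
    unfolding L'_def using that G_single by blast
  have in_G: "(f, L' f) \<in> G" if "f \<in> D'" for f
    using that L'_eq unfolding D'_def by force
  have D'_I: "f \<in> D'" if "(f, z) \<in> G" for f z
    using that unfolding D'_def by force
  have "(?O, L ?O) \<in> G"
    using graph_sub zero unfolding functional_graph_def by blast
  then have "?O \<in> D'"
    by (rule D'_I)
  moreover have "fun_add X f g \<in> D' \<and> L' (fun_add X f g) = L' f + L' g"
    if "f \<in> D'" "g \<in> D'" for f g
    using G_add[OF that[THEN in_G]] by (auto intro: D'_I L'_eq)
  moreover have "fun_scale X c f \<in> D' \<and> L' (fun_scale X c f) = c * L' f"
    if "f \<in> D'" for c f
    using G_scale[OF in_G[OF that]] by (auto intro: D'_I L'_eq)
  moreover have "D' \<subseteq> function_space X"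
    by (intro subsetI G_space[OF in_G])
  ultimately have "is_functional X D' L'"
    by (simp add: is_functional_def linear_subspace_def)
  moreover have "G = functional_graph L' D'"
    unfolding functional_graph_def using in_G L'_eq D'_I by force
  ultimately show ?thesis
    unfolding closable_def G_def by blast
qed

section \<open>Linearity of the minimal extension on cylinder functions\<close>

lemma projective_limit_component:
  assumes "x \<in> projective_limit A r E \<pi>" "J \<in> A"
  shows "x J \<in> E J"
  using assms by (auto simp: projective_limit_def)

text \<open>A point \<open>x\<close> of the limit satisfies \<open>x J = \<pi> J R (x R)\<close>.
  Hence a cylinder function based at \<open>J\<close> can be rewritten as one based at any later
  index \<open>R\<close>.\<close>

lemma ext_lim_ext_map:
  assumes "(J, R) \<in> r" "R \<in> A"
  shows "ext_lim A r E \<pi> R (ext_map E \<pi> J R f) = ext_lim A r E \<pi> J f"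
  using assms by (auto simp: ext_lim_def ext_map_def compose_def restrict_def fun_eq_iff
      projective_limit_def)

text \<open>Since \<open>x J\<close> lies in \<open>E J\<close> for every \<open>x\<close> in the
  limit, the restriction to \<open>E J\<close> built into the operations does not alter the
  pullback.\<close>

lemma ext_lim_fun_add:
  assumes "J \<in> A"
  shows "ext_lim A r E \<pi> J (fun_add (E J) f g) =
    fun_add (projective_limit A r E \<pi>) (ext_lim A r E \<pi> J f) (ext_lim A r E \<pi> J g)"
  using projective_limit_component[OF _ assms]
  by (auto simp: ext_lim_def fun_add_def compose_def fun_eq_iff)

lemma ext_lim_fun_scale:
  assumes "J \<in> A"
  shows "ext_lim A r E \<pi> J (fun_scale (E J) c f) =
    fun_scale (projective_limit A r E \<pi>) c (ext_lim A r E \<pi> J f)"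
  using projective_limit_component[OF _ assms]
  by (auto simp: ext_lim_def fun_scale_def compose_def fun_eq_iff)

lemma ext_lim_zero:
  assumes "J \<in> A"
  shows "ext_lim A r E \<pi> J (\<lambda>x\<in>E J. 0) = (\<lambda>x\<in>projective_limit A r E \<pi>. 0)"
  using projective_limit_component[OF _ assms]
  by (auto simp: ext_lim_def compose_def fun_eq_iff)

text \<open>Directedness brings any two cylinder functions to a common index, where linearity of
  \<open>L_min\<close> becomes that of a single \<open>L R\<close>. Perfectness makes the value
  independent of the index and function chosen.\<close>

lemma is_functional_L_min:
  assumes perf: "perfect_inverse_system A r E \<pi>"
    and sys: "projective_system_of_functionals A r E \<pi> D L"
  shows "is_functional (projective_limit A r E \<pi>)
    (cylinder_functions A r E \<pi> D) (L_min A r E \<pi> D L)"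
proof -
  let ?X = "projective_limit A r E \<pi>"
  let ?C = "cylinder_functions A r E \<pi> D"
  let ?L = "L_min A r E \<pi> D L"
  let ?e = "ext_lim A r E \<pi>"
  note L_min_value = L_min_ext_lim[OF perf sys]
  have fam: "A \<noteq> {}" "directed_set A r"
    using perf by (auto simp: perfect_inverse_system_def projective_family_def)
  have lin: "is_functional (E J) (D J) (L J)" if "J \<in> A" for J
    using sys that by (simp add: projective_system_of_functionals_def)
  have cylI: "?e J f \<in> ?C" if "J \<in> A" "f \<in> D J" for J f
    using that by (auto simp: cylinder_functions_def)
  have space: "?C \<subseteq> function_space ?X"
    by (auto simp: cylinder_functions_def ext_lim_def function_space_def compose_def)
  have zero: "(\<lambda>x\<in>?X. 0) \<in> ?C"
  proof -
    obtain J where J: "J \<in> A"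
      using fam by blast
    then have "(\<lambda>x\<in>E J. 0) \<in> D J"
      using lin[OF J] by (simp add: is_functional_def linear_subspace_def)
    then show ?thesis
      using cylI[OF J] ext_lim_zero[OF J, of r E \<pi>] by metis
  qed
  have add: "fun_add ?X F G \<in> ?C \<and> ?L (fun_add ?X F G) = ?L F + ?L G"
    if FG: "F \<in> ?C" "G \<in> ?C" for F G
  proof -
    obtain J f K g where J: "J \<in> A" "f \<in> D J" "F = ?e J f"
      and K: "K \<in> A" "g \<in> D K" "G = ?e K g"
      using FG by (auto simp: cylinder_functions_def)
    \<comment> \<open>The summands may come from incomparable indices; a common upper bound
      \<open>R\<close> lets both be represented by functions in the one linear space
      \<open>D R\<close>.\<close>
    obtain R where R: "R \<in> A" "(J, R) \<in> r" "(K, R) \<in> r"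
      using fam J K unfolding directed_set_def by blast
    define f' g' where "f' = ext_map E \<pi> J R f" and "g' = ext_map E \<pi> K R g"
    have f': "f' \<in> D R" "F = ?e R f'" and g': "g' \<in> D R" "G = ?e R g'"
      using sys R J K
      by (auto simp: f'_def g'_def projective_system_of_functionals_def ext_lim_ext_map)
    have h: "fun_add (E R) f' g' \<in> D R" "L R (fun_add (E R) f' g') = L R f' + L R g'"
      using lin[OF R(1)] f' g' by (auto simp: is_functional_def linear_subspace_def)
    have "fun_add ?X F G = ?e R (fun_add (E R) f' g')"
      by (simp add: f' g' ext_lim_fun_add[OF R(1)])
    then show ?thesis
      using cylI[OF R(1) h(1)] h R f' g' by (simp add: L_min_value)
  qed
  have scale: "fun_scale ?X c F \<in> ?C \<and> ?L (fun_scale ?X c F) = c * ?L F"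
    if F: "F \<in> ?C" for c F
  proof -
    obtain J f where J: "J \<in> A" "f \<in> D J" "F = ?e J f"
      using F by (auto simp: cylinder_functions_def)
    have h: "fun_scale (E J) c f \<in> D J" "L J (fun_scale (E J) c f) = c * L J f"
      using lin[OF J(1)] J by (auto simp: is_functional_def linear_subspace_def)
    have "fun_scale ?X c F = ?e J (fun_scale (E J) c f)"
      by (simp add: J ext_lim_fun_scale)
    then show ?thesis
      using cylI[OF J(1) h(1)] h J by (simp add: L_min_value)
  qed
  show ?thesis
    unfolding is_functional_def linear_subspace_def using space zero add scale by blast
qed

theorem theorem3:
  fixes A :: "'i set" and r :: "('i \<times> 'i) set"
    and E :: "'i \<Rightarrow> 'e set" and \<pi> :: "'i \<Rightarrow> 'i \<Rightarrow> 'e \<Rightarrow> 'e"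
    and D :: "'i \<Rightarrow> ('e \<Rightarrow> complex) set" and L :: "'i \<Rightarrow> ('e \<Rightarrow> complex) \<Rightarrow> complex"
    and \<tau> :: "(('i \<Rightarrow> 'e) \<Rightarrow> complex) topology"
  assumes "perfect_inverse_system A r E \<pi>"
    and "projective_system_of_functionals A r E \<pi> D L"
    and "topological_vector_space (projective_limit A r E \<pi>) \<tau>"
    and "continuous_map (subtopology \<tau> (cylinder_functions A r E \<pi> D)) euclidean
           (L_min A r E \<pi> D L)"
  shows "closable (projective_limit A r E \<pi>) \<tau>
           (cylinder_functions A r E \<pi> D) (L_min A r E \<pi> D L)"
  \<comment> \<open>Perfectness and the compatibility of the functionals enter through the linearity
    of \<open>L_min\<close>, the topology through the closability of continuous functionals.\<close>
  using continuous_functional_closable[OF is_functional_L_min] assms by blast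

end
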